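(* Let $R>0$ and let $\mathcal{EH}_{[0,R]}^{<\omega}$ be the space of isometry classes of finite subsets of the interval $[0,R]$ (equivalently, of finite subsets of the real line of diameter at most $R$), endowed with the Euclidean-Hausdorff distance. Then its Assouad dimension is infinite: $\dim_A\mathcal{EH}_{[0,R]}^{<\omega}=\infty$.
   Context: Finite subsets of $\mathbb{R}$ are taken nonempty and regarded as metric spaces with the inherited metric. For $X,Y\subseteq\mathbb{R}$ the Hausdorff distance is $d_H(X,Y)=\inf_{\mathcal{R}}\sup_{(x,y)\in\mathcal{R}}|x-y|$, over correspondences $\mathcal{R}\subseteq X\times Y$ (relations in which every $x\in X$ is related to at least one $y\in Y$ and vice versa). The Euclidean-Hausdorff distance is $d_{EH}(X,Y)=\inf\{d_H(i_X(X),i_Y(Y))\mid i_X\colon X\to\mathbb{R},\ i_Y\colon Y\to\mathbb{R}\text{ isometric embeddings}\}$, equivalently $\inf_{f\in\operatorname{Isom}(\mathbb{R})}d_H(X,f(Y))$. It is a metric on isometry classes of finite subsets of $\mathbb{R}$. For a metric space $(X,d)$, $E\subseteq X$ and $r>0$, $N_r(E)$ denotes the least number of open balls of radius at most $r$ that cover $E$ ($\infty$ if no finite number suffices). The Assouad dimension is $$\dim_AX=\inf\{\alpha>0\mid\exists C>0:\ \forall r>0,\ \forall\beta\in(0,1],\ \sup_{x\in X}N_{\beta r}(B^o_d(x,r))<C\beta^{-\alpha}\},$$ where $B^o_d(x,r)$ is the open ball centred at $x$ with radius $r$, and $\inf\emptyset=\infty$. *)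

theory Defs
  imports "HOL-Analysis.Analysis"
begin

section \<open>Assouad dimension\<close>

context Metric_space
begin

text \<open>The covering balls are balls of the whole space: their centres need not lie in \<open>E\<close>.
  The infimum of the empty set in \<^typ>\<open>enat\<close> is \<open>\<infinity>\<close>.\<close>

definition covering_number :: "real \<Rightarrow> 'a set \<Rightarrow> enat" where
  "covering_number r E =
     (INF \<B>\<in>{\<B>. finite \<B> \<and> (\<forall>B\<in>\<B>. \<exists>x\<in>M. \<exists>s. 0 < s \<and> s \<le> r \<and> B = mball x s) \<and> E \<subseteq> \<Union>\<B>}.
        enat (card \<B>))"

definition assouad_dim :: ereal where
  "assouad_dim = Inf {ereal \<alpha> |\<alpha>. \<alpha> > 0 \<and>
     (\<exists>C>0. \<forall>r>0. \<forall>\<beta>\<in>{0<..1}.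
        (SUP x\<in>M. ereal_of_enat (covering_number (\<beta> * r) (mball x r))) < ereal (C * \<beta> powr (- \<alpha>)))}"

end

section \<open>Hausdorff and Euclidean-Hausdorff distance on the line\<close>

definition correspondence :: "'a set \<Rightarrow> 'b set \<Rightarrow> ('a \<times> 'b) set \<Rightarrow> bool" where
  "correspondence X Y S \<longleftrightarrow>
     S \<subseteq> X \<times> Y \<and> (\<forall>x\<in>X. \<exists>y\<in>Y. (x, y) \<in> S) \<and> (\<forall>y\<in>Y. \<exists>x\<in>X. (x, y) \<in> S)"

text \<open>The distances take values in \<^typ>\<open>ennreal\<close>, so that all suprema and infima exist.\<close>

definition hausdorff_dist :: "real set \<Rightarrow> real set \<Rightarrow> ennreal" where
  "hausdorff_dist X Y = (INF S\<in>{S. correspondence X Y S}. SUP (x, y)\<in>S. ennreal \<bar>x - y\<bar>)"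

definition isometry_on :: "real set \<Rightarrow> (real \<Rightarrow> real) \<Rightarrow> bool" where
  "isometry_on X f \<longleftrightarrow> (\<forall>x\<in>X. \<forall>y\<in>X. dist (f x) (f y) = dist x y)"

definition euclidean_hausdorff_dist :: "real set \<Rightarrow> real set \<Rightarrow> ennreal" where
  "euclidean_hausdorff_dist X Y =
     (INF (f, g)\<in>{(f, g). isometry_on X f \<and> isometry_on Y g}. hausdorff_dist (f ` X) (g ` Y))"

section \<open>The space of isometry classes of finite subsets of an interval\<close>

definition isometric :: "real set \<Rightarrow> real set \<Rightarrow> bool" where
  "isometric X Y \<longleftrightarrow> (\<exists>f. isometry_on X f \<and> f ` X = Y)"

definition finite_subsets :: "real \<Rightarrow> real set set" where
  "finite_subsets R = {X. finite X \<and> X \<noteq> {} \<and> X \<subseteq> {0..R}}"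

definition isometry_rel :: "real \<Rightarrow> (real set \<times> real set) set" where
  "isometry_rel R = {(X, Y). X \<in> finite_subsets R \<and> Y \<in> finite_subsets R \<and> isometric X Y}"

definition EH_space :: "real \<Rightarrow> real set set set" where
  "EH_space R = finite_subsets R // isometry_rel R"

text \<open>On \<^term>\<open>EH_space R\<close> the choice of representatives is irrelevant and the distance is finite;
  see \<open>EH_dist_class\<close> and \<open>euclidean_hausdorff_dist_finite\<close> below.\<close>

definition EH_dist :: "real set set \<Rightarrow> real set set \<Rightarrow> real" where
  "EH_dist P Q = enn2real (euclidean_hausdorff_dist (SOME X. X \<in> P) (SOME Y. Y \<in> Q))"

section \<open>The space of isometry classes is a metric space\<close>

lemma isometry_on_affine:
  assumes "isometry_on X f"
  obtains c s where "\<bar>s\<bar> = 1" "\<And>x. x \<in> X \<Longrightarrow> f x = c + s * x"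
proof (cases "\<exists>a\<in>X. \<exists>b\<in>X. a \<noteq> b")
  case True
  then obtain a b where ab: "a \<in> X" "b \<in> X" "a \<noteq> b" by blast
  define s where "s = (f b - f a) / (b - a)"
  have d: "\<bar>f x - f y\<bar> = \<bar>x - y\<bar>" if "x \<in> X" "y \<in> X" for x y
    using assms that by (auto simp: isometry_on_def dist_real_def)
  have "\<bar>s\<bar> = 1" using d[OF ab(2,1)] ab by (simp add: s_def abs_divide)
  moreover have "f x = (f a - s * a) + s * x" if "x \<in> X" for x
  proof -
    have fb: "f b - f a = s * (b - a)" using ab by (simp add: s_def)
    have "s = 1 \<or> s = - 1" using \<open>\<bar>s\<bar> = 1\<close> by linarith
    then show ?thesis using fb d[OF that ab(1)] d[OF that ab(2)] ab(3)
      by (elim disjE; simp add: abs_if split: if_splits)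
  qed
  ultimately show ?thesis using that by blast
next
  case False
  show ?thesis
  proof (cases "X = {}")
    case True then show ?thesis using that[of 1 0] by simp
  next
    case F: False
    then obtain a where "a \<in> X" by blast
    with False have "x = a" if "x \<in> X" for x using that by blast
    then show ?thesis using that[of 1 "f a - a"] by auto
  qed
qed

lemma isometry_on_compose:
  "isometry_on X f \<Longrightarrow> isometry_on UNIV h \<Longrightarrow> isometry_on X (\<lambda>x. h (f x))"
  by (simp add: isometry_on_def)

lemma isometry_on_match:
  assumes "isometry_on Y g" "isometry_on Y g'"
  obtains w where "isometry_on UNIV w" "\<And>y. y \<in> Y \<Longrightarrow> w (g' y) = g y"
proof -
  obtain c s where s: "\<bar>s\<bar> = 1" "\<And>x. x \<in> Y \<Longrightarrow> g x = c + s * x"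
    using isometry_on_affine[OF assms(1)] by metis
  obtain c' s' where s': "\<bar>s'\<bar> = 1" "\<And>x. x \<in> Y \<Longrightarrow> g' x = c' + s' * x"
    using isometry_on_affine[OF assms(2)] by metis
  have ss: "s' * s' = 1" using s'(1) by (metis abs_mult_self_eq mult_1)
  define w where "w t = c + s * (s' * (t - c'))" for t
  have "\<bar>w x - w y\<bar> = \<bar>x - y\<bar>" for x y
  proof -
    have "w x - w y = s * (s' * (x - y))" by (simp add: w_def algebra_simps)
    then show ?thesis using s(1) s'(1) by (simp add: abs_mult)
  qed
  then have "isometry_on UNIV w" by (simp add: isometry_on_def dist_real_def)
  moreover have "w (g' y) = g y" if "y \<in> Y" for y
  proof -
    have "w (g' y) = c + s * ((s' * s') * y)" using s'(2)[OF that] by (simp add: w_def)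
    then show ?thesis using ss s(2)[OF that] by simp
  qed
  ultimately show ?thesis using that by blast
qed

lemma euclidean_hausdorff_dist_lessD:
  assumes "euclidean_hausdorff_dist X Y < ennreal e"
  obtains f g S where "isometry_on X f" "isometry_on Y g" "correspondence X Y S"
    "\<And>x y. (x, y) \<in> S \<Longrightarrow> \<bar>f x - g y\<bar> < e"
proof -
  obtain f g where fg: "isometry_on X f" "isometry_on Y g"
    and "hausdorff_dist (f ` X) (g ` Y) < ennreal e"
    using assms unfolding euclidean_hausdorff_dist_def by (auto simp: INF_less_iff)
  then obtain T where T: "correspondence (f ` X) (g ` Y) T"
    and lt: "(SUP (x, y)\<in>T. ennreal \<bar>x - y\<bar>) < ennreal e"
    unfolding hausdorff_dist_def by (auto simp: INF_less_iff)
  define S where "S = {(x, y). x \<in> X \<and> y \<in> Y \<and> (f x, g y) \<in> T}"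
  have "correspondence X Y S"
    using T unfolding correspondence_def S_def by fast
  moreover have "\<bar>f x - g y\<bar> < e" if "(x, y) \<in> S" for x y
  proof -
    have "ennreal \<bar>f x - g y\<bar> \<le> (SUP (x, y)\<in>T. ennreal \<bar>x - y\<bar>)"
      using that by (intro SUP_upper2[of "(f x, g y)"]) (auto simp: S_def)
    with lt have "ennreal \<bar>f x - g y\<bar> < ennreal e" by (rule order.strict_trans1[rotated])
    then show ?thesis by (simp add: ennreal_less_iff)
  qed
  ultimately show ?thesis using that fg by blast
qed

lemma euclidean_hausdorff_dist_leI:
  assumes "isometry_on X f" "isometry_on Y g" "correspondence X Y S"
    and "\<And>x y. (x, y) \<in> S \<Longrightarrow> \<bar>f x - g y\<bar> \<le> e"
  shows "euclidean_hausdorff_dist X Y \<le> ennreal e"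
proof -
  define T where "T = (\<lambda>(x, y). (f x, g y)) ` S"
  have "correspondence (f ` X) (g ` Y) T"
    using assms(3) unfolding correspondence_def T_def by fast
  then have "hausdorff_dist (f ` X) (g ` Y) \<le> (SUP (x, y)\<in>T. ennreal \<bar>x - y\<bar>)"
    unfolding hausdorff_dist_def by (intro INF_lower) simp
  also have "\<dots> \<le> ennreal e"
    using assms(4) by (intro SUP_least) (auto simp: T_def intro!: ennreal_leI)
  finally show ?thesis
    unfolding euclidean_hausdorff_dist_def using assms(1,2)
    by (intro INF_lower2[of "(f, g)"]) auto
qed

lemma correspondence_converse: "correspondence X Y S \<Longrightarrow> correspondence Y X (S\<inverse>)"
  unfolding correspondence_def by blast

lemma correspondence_relcomp:
  "correspondence X Y S \<Longrightarrow> correspondence Y Z T \<Longrightarrow> correspondence X Z (S O T)"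
  unfolding correspondence_def by (safe; blast)

lemma hausdorff_dist_commute: "hausdorff_dist X Y = hausdorff_dist Y X"
proof -
  have *: "hausdorff_dist X Y \<le> hausdorff_dist Y X" for X Y
    unfolding hausdorff_dist_def
  proof (rule INF_greatest)
    fix S assume "S \<in> {S. correspondence Y X S}"
    then have "S\<inverse> \<in> {S. correspondence X Y S}" by (simp add: correspondence_converse)
    then show "(INF S\<in>{S. correspondence X Y S}. SUP (x, y)\<in>S. ennreal \<bar>x - y\<bar>)
      \<le> (SUP (x, y)\<in>S. ennreal \<bar>x - y\<bar>)"
      by (rule INF_lower2) (auto intro!: SUP_least SUP_upper2 simp: abs_minus_commute)
  qed
  show ?thesis by (rule antisym[OF * *])
qed

lemma euclidean_hausdorff_dist_commute:
  "euclidean_hausdorff_dist X Y = euclidean_hausdorff_dist Y X"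
proof -
  have *: "euclidean_hausdorff_dist X Y \<le> euclidean_hausdorff_dist Y X" for X Y
    unfolding euclidean_hausdorff_dist_def
    by (rule INF_greatest, clarify)
      (rule INF_lower2[of "(_, _)"], auto simp: hausdorff_dist_commute)
  show ?thesis by (rule antisym[OF * *])
qed

lemma euclidean_hausdorff_dist_finite:
  assumes "finite X" "X \<noteq> {}" "finite Y" "Y \<noteq> {}"
  shows "euclidean_hausdorff_dist X Y < \<infinity>"
proof -
  define e where "e = Max ((\<lambda>(x, y). \<bar>x - y\<bar>) ` (X \<times> Y))"
  have "euclidean_hausdorff_dist X Y \<le> ennreal e"
  proof (rule euclidean_hausdorff_dist_leI[of _ "\<lambda>x. x" _ "\<lambda>x. x" "X \<times> Y"])
    show "correspondence X Y (X \<times> Y)" using assms by (auto simp: correspondence_def)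
    show "\<bar>x - y\<bar> \<le> e" if "(x, y) \<in> X \<times> Y" for x y
      unfolding e_def using assms that by (intro Max_ge) force+
  qed (auto simp: isometry_on_def)
  then show ?thesis by (simp add: le_less_trans)
qed

lemma euclidean_hausdorff_dist_triangle:
  assumes fin: "finite X" "X \<noteq> {}" "finite Y" "Y \<noteq> {}" "finite Z" "Z \<noteq> {}"
  shows "enn2real (euclidean_hausdorff_dist X Z)
    \<le> enn2real (euclidean_hausdorff_dist X Y) + enn2real (euclidean_hausdorff_dist Y Z)"
    (is "?c \<le> ?a + ?b")
proof (rule field_le_epsilon)
  fix e :: real assume "e > 0"
  have lt: "euclidean_hausdorff_dist A B < ennreal (enn2real (euclidean_hausdorff_dist A B) + e / 2)"
    if "finite A" "A \<noteq> {}" "finite B" "B \<noteq> {}" for A B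
  proof -
    have "euclidean_hausdorff_dist A B = ennreal (enn2real (euclidean_hausdorff_dist A B))"
      using euclidean_hausdorff_dist_finite[OF that] by simp
    also have "\<dots> < ennreal (enn2real (euclidean_hausdorff_dist A B) + e / 2)"
      using \<open>e > 0\<close> by (intro ennreal_lessI) (auto intro: add_nonneg_pos)
    finally show ?thesis .
  qed
  obtain f g S where 1: "isometry_on X f" "isometry_on Y g" "correspondence X Y S"
    "\<And>x y. (x, y) \<in> S \<Longrightarrow> \<bar>f x - g y\<bar> < ?a + e / 2"
    using euclidean_hausdorff_dist_lessD[OF lt[OF fin(1-4)]] by blast
  obtain g' h T where 2: "isometry_on Y g'" "isometry_on Z h" "correspondence Y Z T"
    "\<And>x y. (x, y) \<in> T \<Longrightarrow> \<bar>g' x - h y\<bar> < ?b + e / 2"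
    using euclidean_hausdorff_dist_lessD[OF lt[OF fin(3-6)]] by blast
  obtain w where w: "isometry_on UNIV w" "\<And>y. y \<in> Y \<Longrightarrow> w (g' y) = g y"
    using isometry_on_match[OF 1(2) 2(1)] by blast
  have "euclidean_hausdorff_dist X Z \<le> ennreal (?a + ?b + e)"
  proof (rule euclidean_hausdorff_dist_leI[OF 1(1) isometry_on_compose[OF 2(2) w(1)]
        correspondence_relcomp[OF 1(3) 2(3)]])
    fix x z assume "(x, z) \<in> S O T"
    then obtain y where y: "(x, y) \<in> S" "(y, z) \<in> T" by blast
    then have "y \<in> Y" using 1(3) by (auto simp: correspondence_def)
    then have "\<bar>g y - w (h z)\<bar> = \<bar>g' y - h z\<bar>"
      using w by (metis UNIV_I dist_real_def isometry_on_def)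
    then show "\<bar>f x - w (h z)\<bar> \<le> ?a + ?b + e"
      using 1(4)[OF y(1)] 2(4)[OF y(2)] by linarith
  qed
  then show "?c \<le> ?a + ?b + e"
    using \<open>e > 0\<close> by (metis add_nonneg_nonneg enn2real_leI enn2real_nonneg less_imp_le)
qed

lemma euclidean_hausdorff_dist_eq_0_iff:
  assumes fin: "finite X" "finite Y"
  shows "euclidean_hausdorff_dist X Y = 0 \<longleftrightarrow> isometric X Y"
proof
  assume "isometric X Y"
  then obtain f where f: "isometry_on X f" "f ` X = Y" by (auto simp: isometric_def)
  have "euclidean_hausdorff_dist X Y \<le> ennreal 0"
    by (rule euclidean_hausdorff_dist_leI[OF f(1), of _ "\<lambda>y. y" "(\<lambda>x. (x, f x)) ` X"])
      (use f(2) in \<open>auto simp: isometry_on_def correspondence_def\<close>)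
  then show "euclidean_hausdorff_dist X Y = 0" by simp
next
  assume zero: "euclidean_hausdorff_dist X Y = 0"
  define D where "D = (\<lambda>((x, x'), (y, y')). \<bar>\<bar>x - x'\<bar> - \<bar>y - y'\<bar>\<bar>) ` ((X \<times> X) \<times> (Y \<times> Y)) - {0}"
  have "finite D" using fin by (simp add: D_def)
  have pos: "\<delta> > 0" if "\<delta> \<in> D" for \<delta> using that by (auto simp: D_def)
  obtain e where e: "e > 0" "\<And>\<delta>. \<delta> \<in> D \<Longrightarrow> e \<le> \<delta>"
  proof
    show "Min (insert 1 D) > 0" using \<open>finite D\<close> pos by simp
    show "Min (insert 1 D) \<le> \<delta>" if "\<delta> \<in> D" for \<delta> using \<open>finite D\<close> that by simp
  qed
  have "euclidean_hausdorff_dist X Y < ennreal (e / 2)" using zero e(1) by simp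
  then obtain f g S where 1: "isometry_on X f" "isometry_on Y g" "correspondence X Y S"
    "\<And>x y. (x, y) \<in> S \<Longrightarrow> \<bar>f x - g y\<bar> < e / 2"
    using euclidean_hausdorff_dist_lessD by blast
  have eq: "\<bar>x - x'\<bar> = \<bar>y - y'\<bar>" if "(x, y) \<in> S" "(x', y') \<in> S" for x y x' y'
  proof (rule ccontr)
    assume ne: "\<bar>x - x'\<bar> \<noteq> \<bar>y - y'\<bar>"
    have mem: "x \<in> X" "x' \<in> X" "y \<in> Y" "y' \<in> Y"
      using that 1(3) by (auto simp: correspondence_def)
    then have "\<bar>\<bar>x - x'\<bar> - \<bar>y - y'\<bar>\<bar> \<in> D"
      using ne unfolding D_def by (force intro!: image_eqI[of _ _ "((x, x'), (y, y'))"])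
    then have "e \<le> \<bar>\<bar>x - x'\<bar> - \<bar>y - y'\<bar>\<bar>" by (rule e(2))
    moreover have "\<bar>f x - f x'\<bar> = \<bar>x - x'\<bar>" "\<bar>g y - g y'\<bar> = \<bar>y - y'\<bar>"
      using 1(1,2) mem by (auto simp: isometry_on_def dist_real_def)
    ultimately show False using 1(4)[OF that(1)] 1(4)[OF that(2)] by linarith
  qed
  have "\<forall>x\<in>X. \<exists>y. (x, y) \<in> S" using 1(3) by (auto simp: correspondence_def)
  then obtain k where k: "\<And>x. x \<in> X \<Longrightarrow> (x, k x) \<in> S" by metis
  have "isometry_on X k" unfolding isometry_on_def dist_real_def using eq[OF k k] by simp
  moreover have "k ` X = Y"
  proof
    show "k ` X \<subseteq> Y" using k 1(3) by (auto simp: correspondence_def)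
    show "Y \<subseteq> k ` X"
    proof
      fix y assume "y \<in> Y"
      then obtain x where x: "x \<in> X" "(x, y) \<in> S" using 1(3) by (auto simp: correspondence_def)
      then have "y = k x" using eq[OF x(2) k[OF x(1)]] by simp
      then show "y \<in> k ` X" using x by blast
    qed
  qed
  ultimately show "isometric X Y" by (auto simp: isometric_def)
qed

lemma equiv_isometry_rel: "equiv (finite_subsets R) (isometry_rel R)"
proof (rule equivI)
  show "isometry_rel R \<subseteq> finite_subsets R \<times> finite_subsets R"
    by (auto simp: isometry_rel_def)
  show "refl_on (finite_subsets R) (isometry_rel R)"
    by (auto simp: refl_on_def isometry_rel_def isometric_def isometry_on_def intro!: exI[of _ id])
  show "sym (isometry_rel R)"
    by (rule symI) (auto simp: isometry_rel_def finite_subsets_def euclidean_hausdorff_dist_commute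
        simp flip: euclidean_hausdorff_dist_eq_0_iff)
  show "trans (isometry_rel R)"
  proof (rule transI)
    fix X Y Z assume XY: "(X, Y) \<in> isometry_rel R" and YZ: "(Y, Z) \<in> isometry_rel R"
    then obtain f g where "isometry_on X f" "f ` X = Y" "isometry_on Y g" "g ` Y = Z"
      by (auto simp: isometry_rel_def isometric_def)
    then have "isometric X Z"
      by (auto simp: isometric_def isometry_on_def image_image intro!: exI[of _ "\<lambda>x. g (f x)"])
    then show "(X, Z) \<in> isometry_rel R" using XY YZ by (auto simp: isometry_rel_def)
  qed
qed

lemma EH_dist_class:
  assumes P: "P \<in> EH_space R" "X \<in> P" and Q: "Q \<in> EH_space R" "Y \<in> Q"
  shows "EH_dist P Q = enn2real (euclidean_hausdorff_dist X Y)"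
proof -
  define X' where "X' = (SOME X. X \<in> P)"
  define Y' where "Y' = (SOME Y. Y \<in> Q)"
  have "X' \<in> P" "Y' \<in> Q" unfolding X'_def Y'_def using P Q by (auto intro: someI)
  then have r: "(X, X') \<in> isometry_rel R" "(Y, Y') \<in> isometry_rel R"
    using P Q equiv_isometry_rel[of R] unfolding EH_space_def
    by (meson in_quotient_imp_in_rel insert_subset empty_subsetI)+
  then have fin: "finite X" "X \<noteq> {}" "finite X'" "X' \<noteq> {}" "finite Y" "Y \<noteq> {}" "finite Y'" "Y' \<noteq> {}"
    by (auto simp: isometry_rel_def finite_subsets_def)
  have "euclidean_hausdorff_dist X X' = 0" "euclidean_hausdorff_dist Y Y' = 0"
    using r fin by (simp_all add: euclidean_hausdorff_dist_eq_0_iff isometry_rel_def)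
  then have "enn2real (euclidean_hausdorff_dist X' Y') = enn2real (euclidean_hausdorff_dist X Y)"
    using euclidean_hausdorff_dist_triangle[OF fin(1-6)] euclidean_hausdorff_dist_triangle[OF fin(3,4,1,2,5,6)]
      euclidean_hausdorff_dist_triangle[OF fin(3,4,5-8)] euclidean_hausdorff_dist_triangle[OF fin(3,4,7,8,5,6)]
    by (simp add: euclidean_hausdorff_dist_commute)
  then show ?thesis by (simp add: EH_dist_def X'_def Y'_def)
qed

proposition Metric_space_EH: "Metric_space (EH_space R) EH_dist"
proof
  have rep: "\<exists>X. X \<in> P \<and> finite X \<and> X \<noteq> {}" if P: "P \<in> EH_space R" for P
  proof -
    obtain X where "X \<in> finite_subsets R" "P = isometry_rel R `` {X}"
      using P unfolding EH_space_def quotient_def by blast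
    then show ?thesis
      using equiv_class_self[OF equiv_isometry_rel] by (auto simp: finite_subsets_def)
  qed
  fix P Q
  show "0 \<le> EH_dist P Q" by (simp add: EH_dist_def)
  show "EH_dist P Q = EH_dist Q P" by (simp add: EH_dist_def euclidean_hausdorff_dist_commute)
  assume PQ: "P \<in> EH_space R" "Q \<in> EH_space R"
  obtain X Y where X: "X \<in> P" "finite X" "X \<noteq> {}" and Y: "Y \<in> Q" "finite Y" "Y \<noteq> {}"
    using rep PQ by meson
  have d: "EH_dist P Q = enn2real (euclidean_hausdorff_dist X Y)"
    using EH_dist_class PQ X Y by blast
  show "EH_dist P Q = 0 \<longleftrightarrow> P = Q"
  proof -
    have "EH_dist P Q = 0 \<longleftrightarrow> isometric X Y"
      using euclidean_hausdorff_dist_finite[OF X(2,3) Y(2,3)] X Y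
      by (auto simp: d enn2real_eq_0_iff euclidean_hausdorff_dist_eq_0_iff)
    also have "\<dots> \<longleftrightarrow> (X, Y) \<in> isometry_rel R"
      using PQ X Y in_quotient_imp_subset[OF equiv_isometry_rel]
      by (auto simp: isometry_rel_def EH_space_def)
    also have "\<dots> \<longleftrightarrow> P = Q"
      using quotient_eq_iff[OF equiv_isometry_rel] PQ X Y by (metis EH_space_def)
    finally show ?thesis .
  qed
  fix Q' assume Q': "Q' \<in> EH_space R"
  then obtain Z where Z: "Z \<in> Q'" "finite Z" "Z \<noteq> {}" using rep by meson
  show "EH_dist P Q' \<le> EH_dist P Q + EH_dist Q Q'"
    using euclidean_hausdorff_dist_triangle[OF X(2,3) Y(2,3) Z(2,3)]
      EH_dist_class PQ Q' X(1) Y(1) Z(1) by metis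
qed

end

(*
The doubling property fails uniformly.  Put u = R / (4 (n + 1)) and perturb the grid
{0, 4u, ..., 4(n + 1)u} by adding the single point (4i + 1)u, where i < n.  Every perturbed grid is
within u of the grid.  All of them consist of integer multiples of u, and for i < j the length
(4j + 1)u occurs as the distance of two points of the j-th set but not of the i-th one.  Hence every
correspondence distorts some distance by at least u, and the two sets are u/2 apart however they
are moved.  So a ball of radius 2u needs at least n balls of radius u/4, for every n.
*)
theory Submission
  imports Defs
begin

text \<open>Two points of one open ball of radius at most \<open>r\<close> are less than
  \<open>2 * r\<close> apart, so each covering ball holds at most one point of \<open>T\<close>.
  Choosing a covering ball for each point is therefore injective.\<close>

lemma (in Metric_space) card_separated_le_covering_number:
  assumes "T \<subseteq> E" "T \<subseteq> M"
    and sep: "\<And>x y. x \<in> T \<Longrightarrow> y \<in> T \<Longrightarrow> x \<noteq> y \<Longrightarrow> 2 * r \<le> d x y"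
  shows "enat (card T) \<le> covering_number r E"
  unfolding covering_number_def
proof (rule INF_greatest, clarify)
  fix \<B>
  assume fin: "finite \<B>"
    and ball: "\<forall>B\<in>\<B>. \<exists>x\<in>M. \<exists>s. 0 < s \<and> s \<le> r \<and> B = mball x s" and cov: "E \<subseteq> \<Union>\<B>"
  have "\<forall>x\<in>T. \<exists>B\<in>\<B>. x \<in> B" using assms(1) cov by blast
  then obtain b where b: "\<And>x. x \<in> T \<Longrightarrow> b x \<in> \<B> \<and> x \<in> b x" by metis
  have "inj_on b T"
  proof (rule inj_onI, rule ccontr)
    fix x y assume xy: "x \<in> T" "y \<in> T" "b x = b y" "x \<noteq> y"
    obtain c s where "s \<le> r" "b x = mball c s" using b[OF xy(1)] ball by blast
    then have "c \<in> M" "d c x < r" "d c y < r" using b[OF xy(1)] b[OF xy(2)] xy(3) by auto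
    moreover have "x \<in> M" "y \<in> M" using xy assms(2) by auto
    ultimately have "d x y < 2 * r" using triangle[of x c y] by (simp add: commute)
    then show False using sep[OF xy(1,2,4)] by simp
  qed
  then show "enat (card T) \<le> enat (card \<B>)"
    using b fin by (auto intro: card_inj_on_le)
qed

text \<open>One fixed ratio \<open>\<beta>\<close> refutes every exponent at once: for any
  \<open>C\<close> and \<open>\<alpha>\<close> the bound
  \<open>C * \<beta> powr (- \<alpha>)\<close> is a constant, which the covering numbers exceed. The
  infimum is then over the empty set.\<close>

lemma (in Metric_space) assouad_dim_eq_infinity:
  assumes \<beta>: "0 < \<beta>" "\<beta> \<le> 1"
    and large: "\<And>n. \<exists>x\<in>M. \<exists>r>0. enat n \<le> covering_number (\<beta> * r) (mball x r)"
  shows "assouad_dim = \<infinity>"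
proof -
  have False if C: "\<forall>r>0. \<forall>\<beta>\<in>{0<..1}.
      (SUP x\<in>M. ereal_of_enat (covering_number (\<beta> * r) (mball x r))) < ereal (C * \<beta> powr (- \<alpha>))"
    for C \<alpha>
  proof -
    obtain n where n: "C * \<beta> powr (- \<alpha>) \<le> real n" using real_arch_simple by blast
    obtain x r where xr: "x \<in> M" "r > 0" "enat n \<le> covering_number (\<beta> * r) (mball x r)"
      using large by blast
    have "ereal (real n) \<le> ereal_of_enat (covering_number (\<beta> * r) (mball x r))"
      using xr(3) by (metis ereal_of_enat_le_iff ereal_of_enat_simps(1))
    also have "\<dots> \<le> (SUP x\<in>M. ereal_of_enat (covering_number (\<beta> * r) (mball x r)))"
      using xr(1) by (rule SUP_upper)
    also have "\<dots> < ereal (C * \<beta> powr (- \<alpha>))" using C \<beta> xr(2) by simp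
    finally show False using n by simp
  qed
  then have "{ereal \<alpha> |\<alpha>. \<alpha> > 0 \<and> (\<exists>C>0. \<forall>r>0. \<forall>\<beta>\<in>{0<..1}.
      (SUP x\<in>M. ereal_of_enat (covering_number (\<beta> * r) (mball x r))) < ereal (C * \<beta> powr (- \<alpha>)))} = {}"
    by blast
  then show ?thesis unfolding assouad_dim_def by (simp only: Inf_empty top_ereal_def)
qed

text \<open>Isometries keep distances, so moving matched points by less than \<open>e\<close> each
  changes their mutual distance by less than \<open>2 * e\<close>. This bounds the distance from
  below without examining the embeddings.\<close>

lemma euclidean_hausdorff_dist_ge_distance_gap:
  assumes x: "x \<in> X" "x' \<in> X"
    and gap: "\<And>y y'. y \<in> Y \<Longrightarrow> y' \<in> Y \<Longrightarrow> 2 * e \<le> \<bar>\<bar>x - x'\<bar> - \<bar>y - y'\<bar>\<bar>"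
  shows "ennreal e \<le> euclidean_hausdorff_dist X Y"
proof (rule ccontr)
  assume "\<not> ?thesis"
  then have "euclidean_hausdorff_dist X Y < ennreal e" by simp
  then obtain f g S where 1: "isometry_on X f" "isometry_on Y g" "correspondence X Y S"
    "\<And>x y. (x, y) \<in> S \<Longrightarrow> \<bar>f x - g y\<bar> < e"
    using euclidean_hausdorff_dist_lessD by blast
  obtain y y' where y: "y \<in> Y" "(x, y) \<in> S" "y' \<in> Y" "(x', y') \<in> S"
    using 1(3) x unfolding correspondence_def by meson
  have "\<bar>f x - f x'\<bar> = \<bar>x - x'\<bar>" "\<bar>g y - g y'\<bar> = \<bar>y - y'\<bar>"
    using 1(1,2) x y by (auto simp: isometry_on_def dist_real_def)
  then show False using 1(4)[OF y(2)] 1(4)[OF y(4)] gap[OF y(1,3)] by linarith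
qed

text \<open>Integer coordinates make residues mod 4 available and force unequal distances to differ
  by at least 1.\<close>

definition grid :: "nat \<Rightarrow> int set" where
  "grid n = {k. 0 \<le> k \<and> k \<le> 4 * int n \<and> 4 dvd k}"

definition marked_grid :: "nat \<Rightarrow> nat \<Rightarrow> int set" where
  "marked_grid n i = insert (4 * int i + 1) (grid n)"

text \<open>A difference congruent to 1 mod 4 must be the marked point minus a nonnegative multiple
  of 4, hence is at most \<open>4 * int i + 1\<close>.\<close>

lemma marked_grid_distance_neq:
  assumes "a \<in> marked_grid n i" "b \<in> marked_grid n i" "i < j"
  shows "\<bar>a - b\<bar> \<noteq> 4 * int j + 1"
proof -
  have rep: "\<exists>p s. a = 4 * p + s \<and> 0 \<le> p \<and> (s = 0 \<or> s = 1 \<and> p = int i)"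
    if "a \<in> marked_grid n i" for a
  proof (cases "4 dvd a")
    case True
    then obtain k where "a = 4 * k" by (rule dvdE)
    then show ?thesis using that
      by (intro exI[of _ k] exI[of _ 0]) (auto simp: marked_grid_def grid_def)
  next
    case False
    then show ?thesis using that
      by (intro exI[of _ "int i"] exI[of _ 1]) (auto simp: marked_grid_def grid_def)
  qed
  have "a - b \<noteq> 4 * int j + 1" if ab: "a \<in> marked_grid n i" "b \<in> marked_grid n i" for a b
  proof
    assume eq: "a - b = 4 * int j + 1"
    obtain p s where p: "a = 4 * p + s" "0 \<le> p" "s = 0 \<or> s = 1 \<and> p = int i"
      using rep[OF ab(1)] by blast
    obtain q t where q: "b = 4 * q + t" "0 \<le> q" "t = 0 \<or> t = 1 \<and> q = int i"
      using rep[OF ab(2)] by blast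
    \<comment> \<open>Since \<open>4 * x\<close> lies between 0 and 2, \<open>x\<close> vanishes and
      \<open>p = q + int j\<close>, which is too large for \<open>p = int i\<close>.\<close>
    define x where "x = p - q - int j"
    have eq': "4 * x = 1 + t - s" using eq p(1) q(1) by (simp add: x_def)
    moreover have "0 \<le> 1 + t - s" "1 + t - s \<le> 2" using p(3) q(3) by auto
    ultimately have "x = 0" by presburger
    moreover from this have "s = 1" using eq' p(3) q(3) by auto
    ultimately show False using p(3) q(2) assms(3) by (simp add: x_def)
  qed
  then show ?thesis using assms(1,2) by (metis abs_if minus_diff_eq)
qed

definition scaled :: "real \<Rightarrow> int set \<Rightarrow> real set" where
  "scaled u K = (\<lambda>k. u * of_int k) ` K"

lemma scaled_marked_grid_separated:
  assumes u: "u > 0" and ij: "i < j"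
  shows "ennreal (u / 2)
    \<le> euclidean_hausdorff_dist (scaled u (marked_grid n j)) (scaled u (marked_grid n i))"
proof (rule euclidean_hausdorff_dist_ge_distance_gap)
  \<comment> \<open>The pair realising the missing length: the origin and the marked point of the
    set with the larger index.\<close>
  show "u * of_int 0 \<in> scaled u (marked_grid n j)"
    unfolding scaled_def by (rule imageI) (simp add: marked_grid_def grid_def)
  show "u * of_int (4 * int j + 1) \<in> scaled u (marked_grid n j)"
    unfolding scaled_def by (rule imageI) (simp add: marked_grid_def)
  fix y y' assume "y \<in> scaled u (marked_grid n i)" "y' \<in> scaled u (marked_grid n i)"
  then obtain a b where ab: "a \<in> marked_grid n i" "b \<in> marked_grid n i"
    "y = u * of_int a" "y' = u * of_int b"
    by (auto simp: scaled_def)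
  define m where "m = 4 * int j + 1 - \<bar>a - b\<bar>"
  have "1 \<le> \<bar>m\<bar>" using marked_grid_distance_neq[OF ab(1,2) ij] by (simp add: m_def)
  then have "1 \<le> \<bar>real_of_int m\<bar>" by linarith
  moreover have "\<bar>y - y'\<bar> = u * of_int \<bar>a - b\<bar>"
    using u by (simp add: ab(3,4) abs_mult flip: right_diff_distrib)
  then have "\<bar>u * of_int 0 - u * of_int (4 * int j + 1)\<bar> - \<bar>y - y'\<bar> = u * of_int m"
    using u by (simp add: m_def abs_mult right_diff_distrib)
  ultimately show "2 * (u / 2) \<le> \<bar>\<bar>u * of_int 0 - u * of_int (4 * int j + 1)\<bar> - \<bar>y - y'\<bar>\<bar>"
    using u by (simp add: abs_mult)
qed

text \<open>Neither set is moved: the marked point is matched with its left neighbour in the grid,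
  at distance \<open>u\<close>, and every other point with itself.\<close>

lemma scaled_marked_grid_near_grid:
  assumes u: "u > 0" and i: "i < n"
  shows "euclidean_hausdorff_dist (scaled u (grid n)) (scaled u (marked_grid n i)) \<le> ennreal u"
proof -
  let ?X = "scaled u (grid n)" and ?z = "u * of_int (4 * int i + 1)"
  let ?S = "insert (u * of_int (4 * int i), ?z) ((\<lambda>x. (x, x)) ` ?X)"
  have "u * of_int (4 * int i) \<in> ?X"
    unfolding scaled_def by (rule imageI) (use i in \<open>simp add: grid_def\<close>)
  moreover have "scaled u (marked_grid n i) = insert ?z ?X"
    by (simp add: scaled_def marked_grid_def)
  ultimately have "correspondence ?X (scaled u (marked_grid n i)) ?S"
    by (auto simp: correspondence_def)
  then show ?thesis
    by (rule euclidean_hausdorff_dist_leI[of _ "\<lambda>x. x" _ "\<lambda>x. x", rotated 2])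
      (use u in \<open>auto simp: isometry_on_def algebra_simps\<close>)
qed

lemma scaled_in_finite_subsets:
  assumes "u \<ge> 0" "K \<noteq> {}" "K \<subseteq> {0..N}" "u * of_int N \<le> R"
  shows "scaled u K \<in> finite_subsets R"
proof -
  have "0 \<le> u * of_int k \<and> u * of_int k \<le> R" if "k \<in> K" for k
  proof -
    have "0 \<le> k" "k \<le> N" using that assms(3) by auto
    then have "u * of_int k \<le> u * of_int N" using assms(1) by (intro mult_left_mono) auto
    then show ?thesis using assms(1,4) \<open>0 \<le> k\<close> by simp
  qed
  moreover have "finite K" using assms(3) finite_subset by blast
  ultimately show ?thesis using assms(2) by (auto simp: finite_subsets_def scaled_def)
qed

text \<open>The ratio 1/8 compares two radii: \<open>2 * u\<close>, whose open ball contains all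
  sets within \<open>u\<close> of the grid, and \<open>u / 4\<close>, half of their separation
  \<open>u / 2\<close>.\<close>

lemma EH_covering_number_unbounded:
  assumes R: "R > 0"
  shows "\<exists>x\<in>EH_space R. \<exists>r>0.
    enat n \<le> Metric_space.covering_number (EH_space R) EH_dist (1 / 8 * r)
      (Metric_space.mball (EH_space R) EH_dist x r)"
proof -
  interpret Metric_space "EH_space R" EH_dist by (rule Metric_space_EH)
  \<comment> \<open>The last grid point lands exactly on \<open>R\<close>; \<open>Suc n\<close>
    keeps the denominator positive for \<open>n = 0\<close>.\<close>
  define u where "u = R / (4 * real (Suc n))"
  have u: "u > 0" and uR: "u * of_int (4 * int (Suc n)) \<le> R" using R by (simp_all add: u_def)
  define cls where "cls K = isometry_rel R `` {scaled u K}" for K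
  have fs: "scaled u K \<in> finite_subsets R"
    if "K \<noteq> {}" "K \<subseteq> {0..4 * int (Suc n)}" for K
    using scaled_in_finite_subsets[OF _ that uR] u by simp
  have g: "scaled u (grid (Suc n)) \<in> finite_subsets R"
    by (rule fs) (auto simp: grid_def)
  have mg: "scaled u (marked_grid (Suc n) i) \<in> finite_subsets R" if "i < n" for i
    using that by (intro fs) (auto simp: grid_def marked_grid_def)
  have EH: "cls K \<in> EH_space R" "scaled u K \<in> cls K" if "scaled u K \<in> finite_subsets R" for K
    using that equiv_class_self[OF equiv_isometry_rel]
    by (auto simp: cls_def EH_space_def intro: quotientI)
  have dist: "EH_dist (cls K) (cls L) = enn2real (euclidean_hausdorff_dist (scaled u K) (scaled u L))"
    if "scaled u K \<in> finite_subsets R" "scaled u L \<in> finite_subsets R" for K L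
    using EH_dist_class EH that by blast
  define m where "m i = cls (marked_grid (Suc n) i)" for i
  have sep': "u / 2 \<le> EH_dist (m j) (m i)" if "i < j" "j < n" for i j
  proof -
    let ?d = "euclidean_hausdorff_dist (scaled u (marked_grid (Suc n) j))
      (scaled u (marked_grid (Suc n) i))"
    \<comment> \<open>\<open>enn2real\<close> sends \<open>top\<close> to 0, so it preserves the
      lower bound only for a finite distance.\<close>
    have "?d < top"
      using mg[of i] mg[of j] that euclidean_hausdorff_dist_finite
      by (simp add: finite_subsets_def)
    then have "enn2real (ennreal (u / 2)) \<le> enn2real ?d"
      by (intro enn2real_mono scaled_marked_grid_separated[OF u \<open>i < j\<close>])
    then show ?thesis using u mg that by (simp add: m_def dist)
  qed
  have sep: "u / 2 \<le> EH_dist (m i) (m j)" if "i < n" "j < n" "i \<noteq> j" for i j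
    using sep'[of i j] sep'[of j i] that commute by (metis nat_neq_iff)
  have mM: "m i \<in> EH_space R" if "i < n" for i using EH mg that by (simp add: m_def)
  \<comment> \<open>Positive separation makes the classes distinct, so there are exactly
    \<open>n\<close> of them.\<close>
  have inj: "inj_on m {..<n}"
  proof (rule inj_onI, rule ccontr)
    fix i j assume *: "i \<in> {..<n}" "j \<in> {..<n}" "m i = m j" "i \<noteq> j"
    then show False using sep[of i j] mdist_zero[OF mM[of j]] u by auto
  qed
  have near: "m i \<in> mball (cls (grid (Suc n))) (2 * u)" if "i < n" for i
  proof -
    have "EH_dist (cls (grid (Suc n))) (m i) \<le> u"
      using enn2real_leI[OF _ scaled_marked_grid_near_grid[OF u, of i "Suc n"], OF _ less_SucI] u that g mg
      by (simp add: m_def dist)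
    then show ?thesis using EH(1)[OF g] mM[OF that] u by simp
  qed
  have "enat (card (m ` {..<n}))
      \<le> covering_number (1 / 8 * (2 * u)) (mball (cls (grid (Suc n))) (2 * u))"
  proof (rule card_separated_le_covering_number)
    show "m ` {..<n} \<subseteq> mball (cls (grid (Suc n))) (2 * u)" using near by blast
    show "m ` {..<n} \<subseteq> EH_space R" using mM by blast
    show "2 * (1 / 8 * (2 * u)) \<le> EH_dist x y"
      if "x \<in> m ` {..<n}" "y \<in> m ` {..<n}" "x \<noteq> y" for x y
      using that sep by force
  qed
  then show ?thesis using EH(1)[OF g] u card_image[OF inj]
    by (intro bexI[of _ "cls (grid (Suc n))"] exI[of _ "2 * u"]) simp_all
qed

theorem proposition5p3:
  fixes R :: real
  assumes "R > 0"
  shows "Metric_space.assouad_dim (EH_space R) EH_dist = \<infinity>"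
  using Metric_space.assouad_dim_eq_infinity[OF Metric_space_EH _ _ EH_covering_number_unbounded[OF assms]]
  by simp

end
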